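(* There are absolute constants $K,c>0$ such that for every sufficiently large $n\in\mathbb N$ there is a function $f:\{0,1\}^{n^2}\to\{0,1\}$ with $\mathrm{EC}(f)\le K n$ and $C(f)\ge c\,n^2$. In particular, $C(f)=\Omega(\mathrm{EC}(f)^2)$ for this family of functions.
   Context: Let $f:\{0,1\}^N\to\{0,1\}$ and $[N]=\{1,\dots,N\}$. Certificate complexity: an assignment is a map $A:[N]\to\{0,1,*\}$, identified with the subcube $\{x: \forall i,\ x_i=A(i)\text{ or }A(i)=*\}$; its size is $|A|=|\{i:A(i)\ne *\}|$. A $b$-certificate for $f$ is an assignment $A$ such that $x\in A\Rightarrow f(x)=b$. $C(f,x)$ is the size of the smallest $f(x)$-certificate consistent with $x$ (i.e. with $x\in A$), and $C(f)=\max_x C(f,x)$. The expectational certificate complexity $\mathrm{EC}(f)$ is the optimal value of the following program over families $\{w_x\}_{x\in\{0,1\}^N}$, $w_x\in\mathbb R^N$: minimize $\max_{x}\sum_{i=1}^N w_x(i)$ subject to $\sum_{i:x_i\ne y_i} w_x(i)w_y(i)\ge 1$ for all $x,y$ with $f(x)\ne f(y)$, and $0\le w_x(i)\le 1$ for all $x\in\{0,1\}^N$, $i\in[N]$. *)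

theory Defs
  imports Complex_Main "HOL-Library.FuncSet" "HOL-Library.Landau_Symbols"
begin

text \<open>Bits are booleans (\<open>False\<close> for 0, \<open>True\<close> for 1). A point of the \<open>N\<close>-cube is an extensional
  function on \<open>{1..N}\<close>, so the cube is finite and two points are equal iff they agree on all
  coordinates. A Boolean function on the \<open>N\<close>-cube is given by a HOL function
  \<open>(nat \<Rightarrow> bool) \<Rightarrow> bool\<close>, of which only the values on \<open>cube N\<close> are used below.\<close>

definition cube :: "nat \<Rightarrow> (nat \<Rightarrow> bool) set" where
  "cube N = {1..N} \<rightarrow>\<^sub>E (UNIV :: bool set)"

text \<open>In an assignment the value \<open>None\<close> plays the role of the star; outside \<open>{1..N}\<close> the value is
  \<open>None\<close> by convention, so that the size of an assignment is the cardinality of its domain.\<close>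

definition assignments :: "nat \<Rightarrow> (nat \<rightharpoonup> bool) set" where
  "assignments N = {A. dom A \<subseteq> {1..N}}"

definition subcube :: "nat \<Rightarrow> (nat \<rightharpoonup> bool) \<Rightarrow> (nat \<Rightarrow> bool) set" where
  "subcube N A = {x \<in> cube N. \<forall>i\<in>{1..N}. A i = Some (x i) \<or> A i = None}"

definition asize :: "(nat \<rightharpoonup> bool) \<Rightarrow> nat" where
  "asize A = card (dom A)"

definition is_certificate ::
    "nat \<Rightarrow> ((nat \<Rightarrow> bool) \<Rightarrow> bool) \<Rightarrow> bool \<Rightarrow> (nat \<rightharpoonup> bool) \<Rightarrow> bool" where
  "is_certificate N f b A \<longleftrightarrow> A \<in> assignments N \<and> (\<forall>x\<in>subcube N A. f x = b)"

definition cert_at :: "nat \<Rightarrow> ((nat \<Rightarrow> bool) \<Rightarrow> bool) \<Rightarrow> (nat \<Rightarrow> bool) \<Rightarrow> nat" where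
  "cert_at N f x =
     (LEAST k. \<exists>A. is_certificate N f (f x) A \<and> x \<in> subcube N A \<and> asize A = k)"

definition cert :: "nat \<Rightarrow> ((nat \<Rightarrow> bool) \<Rightarrow> bool) \<Rightarrow> nat" where
  "cert N f = Max (cert_at N f ` cube N)"

definition EC_feasible ::
    "nat \<Rightarrow> ((nat \<Rightarrow> bool) \<Rightarrow> bool) \<Rightarrow> ((nat \<Rightarrow> bool) \<Rightarrow> nat \<Rightarrow> real) \<Rightarrow> bool" where
  "EC_feasible N f w \<longleftrightarrow>
     (\<forall>x\<in>cube N. \<forall>y\<in>cube N. f x \<noteq> f y \<longrightarrow>
        (\<Sum>i | i \<in> {1..N} \<and> x i \<noteq> y i. w x i * w y i) \<ge> 1) \<and>
     (\<forall>x\<in>cube N. \<forall>i\<in>{1..N}. 0 \<le> w x i \<and> w x i \<le> 1)"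

definition EC_objective :: "nat \<Rightarrow> ((nat \<Rightarrow> bool) \<Rightarrow> nat \<Rightarrow> real) \<Rightarrow> real" where
  "EC_objective N w = Max ((\<lambda>x. \<Sum>i=1..N. w x i) ` cube N)"

text \<open>The infimum is taken over a nonempty set (all weights 1 are feasible) that is bounded
  below by 0.\<close>

definition EC :: "nat \<Rightarrow> ((nat \<Rightarrow> bool) \<Rightarrow> bool) \<Rightarrow> real" where
  "EC N f = Inf {EC_objective N w | w. EC_feasible N f w}"

end

theory Submission
  imports Defs
begin

text \<open>The function is an OR of \<open>n\<close> copies of the indicator of the nonzero words of a binary linear
  code of length \<open>n\<close> whose distance and dimension are both linear in \<open>n\<close>.
  The code has a nonzero word vanishing on any prescribed \<open>n div 6\<close> coordinates, so a certificate for
  the all-zero input must fix more than \<open>n div 6\<close> coordinates in each row.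
  Fractionally a row that is not a nonzero codeword is cheap: it is far from all codewords but at most one,
  so weight \<open>O(1/n)\<close> on every coordinate, plus weight 1 on one coordinate where it differs from
  the exceptional codeword, separates it from the code at total cost \<open>O(1)\<close>.\<close>

section \<open>Linear codes\<close>

text \<open>Give each subset \<open>B\<close> of \<open>U\<close> the weight
  \<open>(1/4) ^ card B\<close>. All weights together make \<open>(1 + 1/4) ^ card U\<close>, while
  a set of size at most \<open>k\<close> weighs at least \<open>(1/4) ^ k\<close>.\<close>

lemma card_small_subsets:
  assumes "finite U"
  shows "real (card {B \<in> Pow U. card B \<le> k}) \<le> (5/4) ^ card U * 4 ^ k"
proof -
  let ?S = "{B \<in> Pow U. card B \<le> k}"
  have "real (card ?S) * (1/4) ^ k = (\<Sum>B\<in>?S. (1/4) ^ k)"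
    by simp
  also have "\<dots> \<le> (\<Sum>B\<in>?S. (1/4) ^ card B)"
    by (intro sum_mono power_decreasing) auto
  also have "\<dots> \<le> (\<Sum>B\<in>Pow U. (1/4) ^ card B)"
    using assms by (intro sum_mono2) auto
  also have "\<dots> = (\<Prod>u\<in>U. 1/4 + 1)"
    using assms by (subst prod_add) auto
  finally show ?thesis
    by (simp add: field_simps)
qed

text \<open>Words are represented by their supports, so \<open>sym_diff\<close> is addition over the
  two-element field and \<open>card\<close> is the Hamming weight. By linearity the bound on nonzero
  weights is also a bound on distances: distinct words differ in more than \<open>k\<close>
  places.\<close>

definition linear_code :: "'a set \<Rightarrow> nat \<Rightarrow> 'a set set \<Rightarrow> bool" where
  "linear_code U k G \<longleftrightarrow> G \<subseteq> Pow U \<and> {} \<in> G \<and>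
     (\<forall>X\<in>G. \<forall>Y\<in>G. sym_diff X Y \<in> G) \<and> (\<forall>X\<in>G. X \<noteq> {} \<longrightarrow> k < card X)"

text \<open>The new set is the span of \<open>G\<close> and \<open>V\<close>, that is,
  \<open>G\<close> and its coset through \<open>V\<close>. Adding two words of the coset cancels
  \<open>V\<close>, and \<open>far\<close> bounds the weights in the coset.\<close>

lemma linear_code_extend:
  assumes G: "linear_code U k G" and V: "V \<subseteq> U" and far: "\<And>X. X \<in> G \<Longrightarrow> k < card (sym_diff V X)"
  shows "linear_code U k (G \<union> sym_diff V ` G)"
proof -
  have closed: "\<And>X Y. X \<in> G \<Longrightarrow> Y \<in> G \<Longrightarrow> sym_diff X Y \<in> G"
    using G by (simp add: linear_code_def)
  have translate: "sym_diff V X \<in> G \<union> sym_diff V ` G" if "X \<in> G" for X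
    using that by (rule UnI2[OF imageI])
  have sym_diff_translate: "sym_diff X Y \<in> G \<union> sym_diff V ` G"
    if X: "X \<in> G \<union> sym_diff V ` G" and Y: "Y \<in> G" for X Y
    using X
  proof
    assume "X \<in> G"
    then show ?thesis
      using closed Y by (intro UnI1)
  next
    assume "X \<in> sym_diff V ` G"
    then obtain X' where "X' \<in> G" "X = sym_diff V X'"
      by (rule imageE)
    moreover have "sym_diff (sym_diff V X') Y = sym_diff V (sym_diff X' Y)"
      by blast
    ultimately show ?thesis
      using translate[OF closed[OF _ Y]] by simp
  qed
  have "sym_diff X Y \<in> G \<union> sym_diff V ` G"
    if X: "X \<in> G \<union> sym_diff V ` G" and Y: "Y \<in> G \<union> sym_diff V ` G" for X Y
    using Y
  proof
    assume "Y \<in> G"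
    with X show ?thesis
      by (rule sym_diff_translate)
  next
    assume "Y \<in> sym_diff V ` G"
    then obtain Y' where Y': "Y' \<in> G" "Y = sym_diff V Y'"
      by (rule imageE)
    from X show ?thesis
    proof
      assume "X \<in> G"
      moreover have "sym_diff X Y = sym_diff V (sym_diff X Y')"
        unfolding Y' by blast
      ultimately show ?thesis
        using translate[OF closed[OF _ Y'(1)]] by simp
    next
      assume "X \<in> sym_diff V ` G"
      then obtain X' where "X' \<in> G" "X = sym_diff V X'"
        by (rule imageE)
      moreover from this have "sym_diff X Y = sym_diff X' Y'"
        unfolding Y' by blast
      ultimately show ?thesis
        using closed Y' by simp
    qed
  qed
  moreover have "X \<in> Pow U" "X \<noteq> {} \<longrightarrow> k < card X" if "X \<in> G \<union> sym_diff V ` G" for X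
    using that G V far by (auto simp: linear_code_def)
  moreover have "{} \<in> G \<union> sym_diff V ` G"
    using G by (simp add: linear_code_def)
  ultimately show ?thesis
    unfolding linear_code_def by (intro conjI ballI subsetI)
qed

text \<open>Take a code of largest cardinality. A word at distance more than \<open>k\<close> from
  all of it could be adjoined by \<open>linear_code_extend\<close>, so the balls of radius
  \<open>k\<close> around the codewords cover \<open>Pow U\<close>; counting gives the
  bound.\<close>

lemma gilbert_varshamov:
  assumes "finite U"
  obtains G where "linear_code U k G" "2 ^ card U \<le> card G * card {B \<in> Pow U. card B \<le> k}"
proof -
  have "linear_code U k {{}}"
    by (simp add: linear_code_def)
  moreover have bound: "card G \<le> 2 ^ card U" if "linear_code U k G" for G
    using that assms card_mono[of "Pow U" G] by (simp add: linear_code_def card_Pow)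
  ultimately obtain G where G: "linear_code U k G"
    and max: "\<And>H. linear_code U k H \<Longrightarrow> card H \<le> card G"
    using ex_has_greatest_nat[of "linear_code U k" "{{}}" card "Suc (2 ^ card U)"]
    by (auto simp: less_Suc_eq_le)
  have fin: "finite G"
    using G assms by (meson finite_Pow_iff finite_subset linear_code_def)
  let ?B = "{B \<in> Pow U. card B \<le> k}"
  have "Pow U \<subseteq> (\<lambda>(X, B). sym_diff X B) ` (G \<times> ?B)"
  proof
    fix V assume V: "V \<in> Pow U"
    have "\<exists>X\<in>G. card (sym_diff V X) \<le> k"
    proof (rule ccontr)
      assume "\<not> ?thesis"
      then have far: "\<And>X. X \<in> G \<Longrightarrow> k < card (sym_diff V X)"
        by (simp add: not_le)
      have "V \<notin> G"
        using far[of V] by auto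
      moreover have "V \<in> sym_diff V ` G"
        using G by (intro image_eqI[of _ _ "{}"]) (auto simp: linear_code_def)
      ultimately have "card G < card (G \<union> sym_diff V ` G)"
        using fin by (intro psubset_card_mono) auto
      moreover have "card (G \<union> sym_diff V ` G) \<le> card G"
        using V by (intro max linear_code_extend G far) auto
      ultimately show False
        by simp
    qed
    then obtain X where X: "X \<in> G" "card (sym_diff V X) \<le> k"
      by blast
    moreover have "X \<subseteq> U"
      using X G by (auto simp: linear_code_def)
    moreover have "V = sym_diff X (sym_diff V X)"
      by blast
    ultimately show "V \<in> (\<lambda>(X, B). sym_diff X B) ` (G \<times> ?B)"
      using V by (intro image_eqI[of _ _ "(X, sym_diff V X)"]) auto
  qed
  then have "card (Pow U) \<le> card (G \<times> ?B)"
    using fin assms by (intro surj_card_le) auto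
  with G show ?thesis
    by (intro that) (simp_all add: card_Pow card_cartesian_product assms)
qed

text \<open>Pigeonhole: there are fewer patterns on \<open>T\<close> than codewords, so two
  codewords agree on \<open>T\<close>, and their sum vanishes there.\<close>

lemma linear_code_vanishing_word:
  assumes G: "linear_code U k G" and T: "finite T" "2 ^ card T < card G"
  obtains X where "X \<in> G" "X \<noteq> {}" "X \<inter> T = {}"
proof -
  have "\<not> inj_on (\<lambda>X. X \<inter> T) G"
  proof
    assume "inj_on (\<lambda>X. X \<inter> T) G"
    then have "card G \<le> card (Pow T)"
      using T by (intro card_inj_on_le) auto
    with T show False
      by (simp add: card_Pow)
  qed
  then obtain X Y where "X \<in> G" "Y \<in> G" "X \<noteq> Y" "X \<inter> T = Y \<inter> T"
    by (auto simp: inj_on_def)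
  moreover from this have "sym_diff X Y \<in> G"
    using G by (simp add: linear_code_def)
  ultimately show ?thesis
    by (intro that[of "sym_diff X Y"]) auto
qed

lemma good_code_exists:
  fixes n :: nat
  assumes "6 \<le> n"
  obtains G where "linear_code {..<n} (n div 6) G" "2 ^ (n div 6) < card G"
proof -
  define m where "m = n div 6"
  obtain G where G: "linear_code {..<n} m G"
    and card: "2 ^ n \<le> card G * card {B \<in> Pow {..<n}. card B \<le> m}"
    using gilbert_varshamov[of "{..<n}" m] by auto
  have "1 \<le> m"
    using assms by (simp add: m_def)
  have "(2::real) ^ n \<le> real (card G) * real (card {B \<in> Pow {..<n}. card B \<le> m})"
    using card by (metis of_nat_le_iff of_nat_mult of_nat_numeral of_nat_power)
  also have "\<dots> \<le> real (card G) * ((5/4) ^ n * 4 ^ m)"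
    using card_small_subsets[of "{..<n}" m] by (intro mult_left_mono) auto
  finally have "(8/5) ^ n \<le> real (card G) * 4 ^ m"
    by (simp add: power_divide field_simps flip: power_mult_distrib)
  have "(2::real) ^ m * 4 ^ m = 8 ^ m"
    by (simp flip: power_mult_distrib)
  \<comment> \<open>The rate \<open>n div 6\<close> works because 8 is below
    \<open>(8/5) ^ 6\<close>, which is about 16.8; a positive exponent \<open>m\<close> keeps the
    inequality strict.\<close>
  also have "\<dots> < ((8/5) ^ 6) ^ m"
    using \<open>1 \<le> m\<close> by (intro power_strict_mono) (auto simp: power_divide)
  also have "\<dots> \<le> (8/5) ^ n"
    unfolding power_mult[symmetric] m_def by (intro power_increasing) auto
  also have "\<dots> \<le> real (card G) * 4 ^ m"
    by fact
  finally have "(2::real) ^ m < real (card G)"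
    by simp
  then have "2 ^ m < card G"
    by (metis of_nat_less_iff of_nat_numeral of_nat_power)
  with G show ?thesis
    unfolding m_def by (rule that)
qed

section \<open>Fractional weights separating a word from a code\<close>

lemma fractional_separation:
  assumes U: "finite U" and G: "linear_code U k G" and k: "2 \<le> k"
    and y: "y \<subseteq> U" "y \<notin> G - {{}}"
  obtains v :: "'a \<Rightarrow> real"
  where "\<And>j. 0 \<le> v j" "\<And>j. v j \<le> 1" "(\<Sum>j\<in>U. v j) \<le> 1 + 2 * card U / k"
    "\<And>X. X \<in> G - {{}} \<Longrightarrow> 1 \<le> (\<Sum>j\<in>sym_diff X y. v j)"
proof -
  have fin: "finite (sym_diff X y)" if "X \<in> G" for X
    using that G U y by (meson PowD finite_Diff finite_UnI finite_subset linear_code_def subsetD)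
  \<comment> \<open>A single coordinate takes care of every nonzero codeword within distance
    \<open>k / 2\<close> of \<open>y\<close>, since there is at most one such codeword. If there is
    none, any \<open>j0\<close> will do, even one outside \<open>U\<close>.\<close>
  have "\<exists>j0. \<forall>X\<in>G - {{}}. 2 * card (sym_diff X y) \<le> k \<longrightarrow> j0 \<in> sym_diff X y"
  proof (cases "\<exists>X\<in>G - {{}}. 2 * card (sym_diff X y) \<le> k")
    case True
    then obtain X where X: "X \<in> G - {{}}" "2 * card (sym_diff X y) \<le> k"
      by blast
    with y have "X \<noteq> y"
      by metis
    then obtain j where "j \<in> sym_diff X y"
      by blast
    \<comment> \<open>Triangle inequality: two codewords this close to \<open>y\<close> are at
      distance at most \<open>k\<close>, hence equal.\<close>
    moreover have "Z = X" if Z: "Z \<in> G - {{}}" "2 * card (sym_diff Z y) \<le> k" for Z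
    proof (rule ccontr)
      assume "Z \<noteq> X"
      then have "sym_diff Z X \<noteq> {}"
        by blast
      then have "k < card (sym_diff Z X)"
        using G X Z by (simp add: linear_code_def)
      also have "\<dots> \<le> card (sym_diff Z y \<union> sym_diff X y)"
        using fin X Z by (intro card_mono) auto
      also have "\<dots> \<le> card (sym_diff Z y) + card (sym_diff X y)"
        by (rule card_Un_le)
      finally show False
        using X Z by linarith
    qed
    ultimately show ?thesis
      by blast
  qed blast
  then obtain j0 where j0: "\<And>X. X \<in> G - {{}} \<Longrightarrow> 2 * card (sym_diff X y) \<le> k \<Longrightarrow> j0 \<in> sym_diff X y"
    by blast
  \<comment> \<open>The uniform weight \<open>2 / k\<close> handles words differing from
    \<open>y\<close> in more than \<open>k / 2\<close> places, and the full weight at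
    \<open>j0\<close> handles the exceptional one. The hypothesis \<open>2 \<le> k\<close> keeps the
    weights at most 1.\<close>
  define v :: "'a \<Rightarrow> real" where "v j = (if j = j0 then 1 else 2 / k)" for j
  have v: "0 \<le> v j" "v j \<le> 1" "2 / k \<le> v j" for j
    using k by (auto simp: v_def)
  show ?thesis
  proof
    have "(\<Sum>j\<in>U. v j) \<le> (\<Sum>j\<in>U. (if j = j0 then 1 else 0) + 2 / k)"
      by (intro sum_mono) (auto simp: v_def)
    also have "\<dots> \<le> 1 + 2 * card U / k"
      using U by (auto simp: sum.distrib mult.commute)
    finally show "(\<Sum>j\<in>U. v j) \<le> 1 + 2 * card U / k" .
  next
    fix X assume X: "X \<in> G - {{}}"
    show "1 \<le> (\<Sum>j\<in>sym_diff X y. v j)"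
    proof (cases "2 * card (sym_diff X y) \<le> k")
      case True
      then have "v j0 \<le> (\<Sum>j\<in>sym_diff X y. v j)"
        using j0 X fin v by (intro member_le_sum) auto
      then show ?thesis
        by (simp add: v_def)
    next
      case False
      then have "real k \<le> 2 * real (card (sym_diff X y))"
        by linarith
      then have "1 \<le> (\<Sum>j\<in>sym_diff X y. 2 / real k)"
        using k by (simp add: field_simps)
      also have "\<dots> \<le> (\<Sum>j\<in>sym_diff X y. v j)"
        using v by (intro sum_mono) auto
      finally show ?thesis .
    qed
  qed (use v in auto)
qed

section \<open>General facts on certificates and \<open>EC\<close>\<close>

lemma finite_cube: "finite (cube N)"
  by (simp add: cube_def finite_PiE)

lemma cube_nonempty: "cube N \<noteq> {}"
  by (simp add: cube_def PiE_eq_empty_iff)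

lemma cert_at_witness:
  assumes "x \<in> cube N"
  obtains A where "is_certificate N f (f x) A" "x \<in> subcube N A" "asize A = cert_at N f x"
proof -
  \<comment> \<open>Fixing every bit of \<open>x\<close> yields a certificate, so the
    \<open>LEAST\<close> in \<open>cert_at\<close> ranges over a nonempty set and is
    attained.\<close>
  let ?A = "\<lambda>i. if i \<in> {1..N} then Some (x i) else None"
  have "y = x" if "y \<in> subcube N ?A" for y
  proof (rule PiE_ext)
    show "y \<in> {1..N} \<rightarrow>\<^sub>E UNIV" "x \<in> {1..N} \<rightarrow>\<^sub>E UNIV"
      using that assms by (auto simp: subcube_def cube_def)
    show "y i = x i" if "i \<in> {1..N}" for i
      using that \<open>y \<in> subcube N ?A\<close> by (auto simp: subcube_def)
  qed
  then have "is_certificate N f (f x) ?A"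
    by (auto simp: is_certificate_def assignments_def split: if_splits)
  moreover have "x \<in> subcube N ?A"
    using assms by (auto simp: subcube_def)
  ultimately have "\<exists>k A. is_certificate N f (f x) A \<and> x \<in> subcube N A \<and> asize A = k"
    by blast
  then show ?thesis
    using LeastI_ex[of "\<lambda>k. \<exists>A. is_certificate N f (f x) A \<and> x \<in> subcube N A \<and> asize A = k"] that
    unfolding cert_at_def by blast
qed

lemma cert_at_le_cert: "x \<in> cube N \<Longrightarrow> cert_at N f x \<le> cert N f"
  by (simp add: cert_def finite_cube)

lemma EC_objective_nonneg:
  assumes "EC_feasible N f w"
  shows "0 \<le> EC_objective N w"
proof -
  obtain x where x: "x \<in> cube N"
    using cube_nonempty by blast
  then have "0 \<le> (\<Sum>i=1..N. w x i)"
    using assms by (intro sum_nonneg) (auto simp: EC_feasible_def)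
  then show ?thesis
    unfolding EC_objective_def using x finite_cube by (intro Max_ge_iff[THEN iffD2]) auto
qed

lemma EC_le:
  assumes "EC_feasible N f w" "\<And>x. x \<in> cube N \<Longrightarrow> (\<Sum>i=1..N. w x i) \<le> c"
  shows "EC N f \<le> c"
proof -
  have "EC N f \<le> EC_objective N w"
    unfolding EC_def using assms(1) EC_objective_nonneg by (intro cInf_lower bdd_belowI) auto
  also have "\<dots> \<le> c"
    unfolding EC_objective_def using assms(2) finite_cube cube_nonempty by (intro Max.boundedI) auto
  finally show ?thesis .
qed

text \<open>This makes the set under the infimum in \<open>EC\<close> nonempty, so that a lower
  bound on all objectives passes to \<open>EC\<close>.\<close>

lemma EC_feasible_one: "EC_feasible N f (\<lambda>_ _. 1)"
proof -
  have "1 \<le> card {i \<in> {1..N}. x i \<noteq> y i}" if "x \<in> cube N" "y \<in> cube N" "f x \<noteq> f y" for x y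
  proof -
    have "\<exists>i\<in>{1..N}. x i \<noteq> y i"
      using that PiE_ext[of x "{1..N}" "\<lambda>_. UNIV" y] unfolding cube_def by blast
    then show ?thesis
      by (auto simp: Suc_le_eq card_gt_0_iff)
  qed
  then show ?thesis
    by (fastforce simp: EC_feasible_def)
qed

lemma EC_nonneg: "0 \<le> EC N f"
  unfolding EC_def
proof (rule cInf_greatest)
  show "{EC_objective N w |w. EC_feasible N f w} \<noteq> {}"
    using EC_feasible_one by blast
qed (auto intro: EC_objective_nonneg)

section \<open>The OR of codes\<close>

text \<open>Coordinate \<open>r * n + j + 1\<close> is the entry in row \<open>r < n\<close> and column \<open>j < n\<close>.\<close>

lemma sum_square:
  fixes F :: "nat \<Rightarrow> 'a::comm_monoid_add"
  shows "(\<Sum>i=1..n\<^sup>2. F i) = (\<Sum>r<n. \<Sum>j<n. F (r * n + j + 1))"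
proof -
  have "(\<Sum>i=1..n\<^sup>2. F i) = (\<Sum>i<n * n. F (i + 1))"
    by (simp add: power2_eq_square sum.atLeast1_atMost_eq)
  also have "\<dots> = (\<Sum>r<n. \<Sum>i\<in>{r * n..<r * n + n}. F (i + 1))"
    by (simp add: sum.nat_group)
  also have "\<dots> = (\<Sum>r<n. \<Sum>j<n. F (r * n + j + 1))"
    by (simp add: sum.atLeastLessThan_shift_0[of _ "_ * _"] lessThan_atLeast0 add_ac)
  finally show ?thesis .
qed

lemma position_in_square:
  fixes r j n :: nat
  assumes "r < n" "j < n"
  shows "r * n + j + 1 \<in> {1..n\<^sup>2}"
proof -
  have "r * n + j + 1 \<le> (r + 1) * n"
    using assms by simp
  also have "\<dots> \<le> n * n"
    using assms by (intro mult_right_mono) auto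
  finally show ?thesis
    by (simp add: power2_eq_square)
qed

text \<open>The row is given by its support, with columns counted from 0, so that it can be compared
  with a codeword over \<open>{..<n}\<close>.\<close>

definition row :: "nat \<Rightarrow> (nat \<Rightarrow> bool) \<Rightarrow> nat \<Rightarrow> nat set" where
  "row n x r = {j. j < n \<and> x (r * n + j + 1)}"

definition some_row_in :: "nat \<Rightarrow> nat set set \<Rightarrow> (nat \<Rightarrow> bool) \<Rightarrow> bool" where
  "some_row_in n C x \<longleftrightarrow> (\<exists>r<n. row n x r \<in> C)"

text \<open>A 1-input puts weight 1 on all of one row lying in \<open>C\<close>, at cost
  \<open>n\<close>. A 0-input has no row in \<open>C\<close> and puts the separating weights
  \<open>v\<close> on each row, at cost at most \<open>L\<close> per row. Such a pair is already
  separated inside the row chosen by the 1-input.\<close>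

lemma EC_some_row_in_le:
  assumes L: "1 \<le> L"
    and sep: "\<And>y. y \<subseteq> {..<n} \<Longrightarrow> y \<notin> C \<Longrightarrow> \<exists>v :: nat \<Rightarrow> real.
      (\<forall>j. 0 \<le> v j \<and> v j \<le> 1) \<and> (\<Sum>j<n. v j) \<le> L \<and> (\<forall>X\<in>C. 1 \<le> (\<Sum>j\<in>sym_diff X y. v j))"
  shows "EC (n\<^sup>2) (some_row_in n C) \<le> L * n"
proof -
  obtain v :: "nat set \<Rightarrow> nat \<Rightarrow> real" where v: "\<And>y. y \<subseteq> {..<n} \<Longrightarrow> y \<notin> C \<Longrightarrow>
      (\<forall>j. 0 \<le> v y j \<and> v y j \<le> 1) \<and> (\<Sum>j<n. v y j) \<le> L \<and> (\<forall>X\<in>C. 1 \<le> (\<Sum>j\<in>sym_diff X y. v y j))"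
    using sep by metis
  let ?f = "some_row_in n C"
  define R where "R x = (SOME r. r < n \<and> row n x r \<in> C)" for x
  have R: "R x < n" "row n x (R x) \<in> C" if "?f x" for x
    using that someI_ex[of "\<lambda>r. r < n \<and> row n x r \<in> C"] by (auto simp: some_row_in_def R_def)
  have row_sub: "row n x r \<subseteq> {..<n}" for x r
    by (auto simp: row_def)
  have row0: "row n x r \<notin> C" if "\<not> ?f x" "r < n" for x r
    using that by (auto simp: some_row_in_def)
  define w :: "(nat \<Rightarrow> bool) \<Rightarrow> nat \<Rightarrow> real" where
    "w x i = (if ?f x then (if (i - 1) div n = R x then 1 else 0)
              else v (row n x ((i - 1) div n)) ((i - 1) mod n))" for x i
  have w1: "w x (r * n + j + 1) = (if r = R x then 1 else 0)" if "?f x" "j < n" for x r j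
    using that by (simp add: w_def)
  have w0: "w x (r * n + j + 1) = v (row n x r) j" if "\<not> ?f x" "j < n" for x r j
    using that by (simp add: w_def)
  have sep': "1 \<le> (\<Sum>i | i \<in> {1..n\<^sup>2} \<and> x i \<noteq> y i. w x i * w y i)" if "?f x" "\<not> ?f y" for x y
  proof -
    let ?D = "sym_diff (row n x (R x)) (row n y (R x))"
    let ?p = "\<lambda>j. R x * n + j + 1"
    have D: "?D \<subseteq> {..<n}"
      by (auto simp: row_def)
    have "1 \<le> (\<Sum>j\<in>?D. v (row n y (R x)) j)"
      using v[OF row_sub row0] R that by blast
    also have "\<dots> = (\<Sum>j\<in>?D. w x (?p j) * w y (?p j))"
      using D that w1 w0 by (intro sum.cong) auto
    also have "\<dots> = (\<Sum>i\<in>?p ` ?D. w x i * w y i)"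
      by (subst sum.reindex) (auto simp: inj_on_def)
    also have "\<dots> \<le> (\<Sum>i | i \<in> {1..n\<^sup>2} \<and> x i \<noteq> y i. w x i * w y i)"
    proof (intro sum_mono2)
      show "?p ` ?D \<subseteq> {i. i \<in> {1..n\<^sup>2} \<and> x i \<noteq> y i}"
        using position_in_square[of "R x" n] R[OF that(1)] by (auto simp: row_def)
      \<comment> \<open>The remaining disagreements only add nonnegative terms. The bound
        \<open>i \<le> n * n\<close> places \<open>i\<close> in a genuine row, where the weights
        \<open>v\<close> of the 0-input are known to be nonnegative.\<close>
      fix i assume "i \<in> {i. i \<in> {1..n\<^sup>2} \<and> x i \<noteq> y i} - ?p ` ?D"
      then have "(i - 1) div n < n"
        by (intro less_mult_imp_div_less) (auto simp: power2_eq_square)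
      then show "0 \<le> w x i * w y i"
        using that v[OF row_sub row0] by (simp add: w_def)
    qed auto
    finally show ?thesis .
  qed
  show ?thesis
  proof (rule EC_le)
    show "EC_feasible (n\<^sup>2) ?f w"
      unfolding EC_feasible_def
    proof (intro conjI ballI impI)
      fix x y assume "?f x \<noteq> ?f y"
      \<comment> \<open>The constraint is symmetric in \<open>x\<close> and \<open>y\<close>, so it
        suffices that \<open>sep'\<close> treats a 1-input followed by a 0-input.\<close>
      moreover have "(\<Sum>i | i \<in> {1..n\<^sup>2} \<and> y i \<noteq> x i. w y i * w x i) =
          (\<Sum>i | i \<in> {1..n\<^sup>2} \<and> x i \<noteq> y i. w x i * w y i)"
        by (intro sum.cong) auto
      ultimately show "1 \<le> (\<Sum>i | i \<in> {1..n\<^sup>2} \<and> x i \<noteq> y i. w x i * w y i)"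
        using sep'[of x y] sep'[of y x] by metis
    next
      fix x i assume "i \<in> {1..n\<^sup>2}"
      then have "(i - 1) div n < n"
        by (intro less_mult_imp_div_less) (auto simp: power2_eq_square)
      then show "0 \<le> w x i" "w x i \<le> 1"
        using v[OF row_sub row0] by (simp_all add: w_def)
    qed
    fix x
    show "(\<Sum>i=1..n\<^sup>2. w x i) \<le> L * n"
    proof (cases "?f x")
      case True
      have "(\<Sum>i=1..n\<^sup>2. w x i) = (\<Sum>r<n. \<Sum>j<n. if r = R x then 1 else 0)"
        unfolding sum_square using True w1 by (intro sum.cong) auto
      also have "\<dots> = (\<Sum>r<n. if r = R x then real n else 0)"
        by (intro sum.cong) auto
      also have "\<dots> \<le> real n"
        by simp
      also have "\<dots> \<le> L * n"
        using L by (simp add: mult_le_cancel_right1)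
      finally show ?thesis .
    next
      case False
      have "(\<Sum>i=1..n\<^sup>2. w x i) = (\<Sum>r<n. \<Sum>j<n. v (row n x r) j)"
        unfolding sum_square using False w0 by (intro sum.cong) auto
      also have "\<dots> \<le> (\<Sum>r<n. L)"
        using v[OF row_sub row0] False by (intro sum_mono) auto
      finally show ?thesis
        by (simp add: mult.commute)
    qed
  qed
qed

text \<open>Consider the all-zero input. If its certificate fixed at most \<open>m\<close> entries
  of some row, a word of \<open>C\<close> vanishing on them could be written into that row, giving a
  1-input consistent with a 0-certificate. The rows are disjoint, so their counts add up.\<close>

lemma cert_some_row_in_ge:
  assumes C: "{} \<notin> C" "C \<subseteq> Pow {..<n}"
    and vanishing: "\<And>T. T \<subseteq> {..<n} \<Longrightarrow> card T \<le> m \<Longrightarrow> \<exists>X\<in>C. X \<inter> T = {}"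
  shows "n * (m + 1) \<le> cert (n\<^sup>2) (some_row_in n C)"
proof -
  let ?f = "some_row_in n C"
  define z where "z = (\<lambda>i\<in>{1..n\<^sup>2}. False)"
  have z: "z \<in> cube (n\<^sup>2)"
    by (simp add: z_def cube_def)
  have "row n z r = {}" if "r < n" for r
    using position_in_square[OF that] by (auto simp: row_def z_def)
  then have fz: "\<not> ?f z"
    using C by (auto simp: some_row_in_def)
  obtain A where A: "is_certificate (n\<^sup>2) ?f (?f z) A" "z \<in> subcube (n\<^sup>2) A"
      and size: "asize A = cert_at (n\<^sup>2) ?f z"
    using cert_at_witness[OF z] .
  define T where "T r = {j. j < n \<and> r * n + j + 1 \<in> dom A}" for r
  have many: "m + 1 \<le> card (T r)" if r: "r < n" for r
  proof (rule ccontr)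
    assume "\<not> ?thesis"
    then obtain X where X: "X \<in> C" "X \<inter> T r = {}"
      using vanishing[of "T r"] by (auto simp: T_def)
    \<comment> \<open>The word \<open>X\<close> goes into row \<open>r\<close>, and all other rows
      are zero.\<close>
    define x where "x = (\<lambda>i\<in>{1..n\<^sup>2}. (i - 1) div n = r \<and> (i - 1) mod n \<in> X)"
    have "row n x r = X"
    proof (rule set_eqI)
      fix j
      show "j \<in> row n x r \<longleftrightarrow> j \<in> X"
        using position_in_square[OF r, of j] X C by (cases "j < n") (auto simp: row_def x_def)
    qed
    then have "?f x"
      using X r by (auto simp: some_row_in_def)
    moreover have "x \<in> subcube (n\<^sup>2) A"
      unfolding subcube_def
    proof (intro CollectI conjI ballI)
      show "x \<in> cube (n\<^sup>2)"
        by (simp add: x_def cube_def)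
      fix i assume i: "i \<in> {1..n\<^sup>2}"
      \<comment> \<open>A fixed coordinate where \<open>x\<close> is true would lie in row
        \<open>r\<close>, in a column belonging to both \<open>X\<close> and
        \<open>T r\<close>.\<close>
      have "x i = z i" if "i \<in> dom A"
      proof -
        have "\<not> x i"
        proof
          assume "x i"
          then have *: "(i - 1) div n = r" "(i - 1) mod n \<in> X"
            using i by (auto simp: x_def)
          then have "r * n + (i - 1) mod n + 1 = i"
            using i div_mult_mod_eq[of "i - 1" n] by simp
          then have "(i - 1) mod n \<in> T r"
            using that r by (simp add: T_def)
          with * X show False
            by blast
        qed
        then show ?thesis
          using i by (simp add: z_def)
      qed
      moreover have "A i = Some (z i) \<or> A i = None"
        using A(2) i by (simp add: subcube_def)
      ultimately show "A i = Some (x i) \<or> A i = None"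
        by (auto simp: domI)
    qed
    ultimately show False
      using A(1) fz by (auto simp: is_certificate_def)
  qed
  have dom: "dom A \<subseteq> {1..n\<^sup>2}"
    using A(1) by (simp add: is_certificate_def assignments_def)
  have "n * (m + 1) \<le> (\<Sum>r<n. card (T r))"
    using sum_bounded_below[of "{..<n}" "m + 1" "\<lambda>r. card (T r)"] many by simp
  also have "\<dots> = (\<Sum>r<n. \<Sum>j<n. of_bool (r * n + j + 1 \<in> dom A))"
    by (simp add: T_def Int_def)
  also have "\<dots> = (\<Sum>i=1..n\<^sup>2. of_bool (i \<in> dom A))"
    by (simp only: sum_square)
  also have "\<dots> = asize A"
    using dom by (simp add: asize_def Int_absorb1)
  also have "\<dots> \<le> cert (n\<^sup>2) ?f"
    unfolding size by (rule cert_at_le_cert[OF z])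
  finally show ?thesis .
qed

section \<open>Choice of parameters and the asymptotic statement\<close>

lemma separating_function_exists:
  assumes n: "12 \<le> n"
  shows "\<exists>f. EC (n\<^sup>2) f \<le> 25 * real n \<and> (1/6) * (real n)\<^sup>2 \<le> real (cert (n\<^sup>2) f)"
proof -
  define m where "m = n div 6"
  \<comment> \<open>These facts fix the constants: the first is needed for
    \<open>fractional_separation\<close>, the second turns \<open>1 + 2 * n / m\<close> into 25, and
    the third turns \<open>n * (m + 1)\<close> into a sixth of the square of
    \<open>n\<close>.\<close>
  have m: "2 \<le> m" "n \<le> 12 * m" "n \<le> 6 * (m + 1)"
    using n unfolding m_def by presburger+
  obtain G where G: "linear_code {..<n} m G" "2 ^ m < card G"
    using good_code_exists[of n] n unfolding m_def by auto
  let ?f = "some_row_in n (G - {{}})"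
  have "EC (n\<^sup>2) ?f \<le> 25 * real n"
  proof (rule EC_some_row_in_le)
    fix y assume y: "y \<subseteq> {..<n}" "y \<notin> G - {{}}"
    obtain v :: "nat \<Rightarrow> real" where v: "\<And>j. 0 \<le> v j" "\<And>j. v j \<le> 1"
        "(\<Sum>j<n. v j) \<le> 1 + 2 * card {..<n} / m" "\<And>X. X \<in> G - {{}} \<Longrightarrow> 1 \<le> (\<Sum>j\<in>sym_diff X y. v j)"
      using fractional_separation[OF _ G(1) m(1) y] by auto
    have "1 + 2 * card {..<n} / m \<le> (25::real)"
      using m by (simp add: field_simps)
    with v(3) have "(\<Sum>j<n. v j) \<le> 25"
      by linarith
    with v show "\<exists>v :: nat \<Rightarrow> real. (\<forall>j. 0 \<le> v j \<and> v j \<le> 1) \<and> (\<Sum>j<n. v j) \<le> 25 \<and>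
        (\<forall>X\<in>G - {{}}. 1 \<le> (\<Sum>j\<in>sym_diff X y. v j))"
      by blast
  qed simp
  moreover have "n * (m + 1) \<le> cert (n\<^sup>2) ?f"
  proof (rule cert_some_row_in_ge)
    fix T assume T: "T \<subseteq> {..<n}" "card T \<le> m"
    have "(2::nat) ^ card T \<le> 2 ^ m"
      using T by (intro power_increasing) auto
    then have "2 ^ card T < card G"
      using G by linarith
    moreover have "finite T"
      using T finite_subset by blast
    ultimately obtain X where "X \<in> G" "X \<noteq> {}" "X \<inter> T = {}"
      using linear_code_vanishing_word[OF G(1)] by metis
    then show "\<exists>X\<in>G - {{}}. X \<inter> T = {}"
      by blast
  qed (use G in \<open>auto simp: linear_code_def\<close>)
  moreover have "n * n \<le> 6 * (n * (m + 1))"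
    using mult_le_mono2[OF m(3), of n] by (simp add: algebra_simps)
  ultimately have "EC (n\<^sup>2) ?f \<le> 25 * real n" "n\<^sup>2 \<le> 6 * cert (n\<^sup>2) ?f"
    by (simp_all add: power2_eq_square)
  then have "EC (n\<^sup>2) ?f \<le> 25 * real n \<and> (1/6) * (real n)\<^sup>2 \<le> real (cert (n\<^sup>2) ?f)"
    by (simp flip: of_nat_power)
  then show ?thesis
    by blast
qed

theorem mainTheorem9:
  "\<exists>K::real. \<exists>c::real. K > 0 \<and> c > 0 \<and>
     (\<exists>f :: nat \<Rightarrow> (nat \<Rightarrow> bool) \<Rightarrow> bool.
        (\<forall>\<^sub>F n in sequentially.
           EC (n\<^sup>2) (f n) \<le> K * real n \<and> real (cert (n\<^sup>2) (f n)) \<ge> c * (real n)\<^sup>2) \<and>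
        (\<lambda>n. real (cert (n\<^sup>2) (f n))) \<in> \<Omega>(\<lambda>n. (EC (n\<^sup>2) (f n))\<^sup>2))"
proof -
  \<comment> \<open>For \<open>n\<close> below 12 the function \<open>f n\<close> is arbitrary; both
    conclusions are asymptotic.\<close>
  obtain f where f: "\<And>n. 12 \<le> n \<Longrightarrow>
      EC (n\<^sup>2) (f n) \<le> 25 * real n \<and> (1/6) * (real n)\<^sup>2 \<le> real (cert (n\<^sup>2) (f n))"
    using separating_function_exists by metis
  \<comment> \<open>The constant is 3750 = 6 * 25 * 25. Squaring the upper bound on
    \<open>EC\<close> relies on \<open>EC_nonneg\<close>.\<close>
  have sq: "1 / 3750 * (EC (n\<^sup>2) (f n))\<^sup>2 \<le> real (cert (n\<^sup>2) (f n))" if "12 \<le> n" for n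
  proof -
    have "(EC (n\<^sup>2) (f n))\<^sup>2 \<le> (25 * real n)\<^sup>2"
      using f[OF that] EC_nonneg by (intro power_mono) auto
    then show ?thesis
      using f[OF that] by (simp add: power_mult_distrib)
  qed
  have "\<forall>\<^sub>F n in sequentially. EC (n\<^sup>2) (f n) \<le> 25 * real n \<and>
      real (cert (n\<^sup>2) (f n)) \<ge> (1/6) * (real n)\<^sup>2"
    using f by (auto simp: eventually_sequentially)
  moreover have "(\<lambda>n. real (cert (n\<^sup>2) (f n))) \<in> \<Omega>(\<lambda>n. (EC (n\<^sup>2) (f n))\<^sup>2)"
    using sq by (intro landau_omega.bigI[of "1 / 3750"]) (auto simp: eventually_sequentially)
  moreover have "(25::real) > 0" "(1/6::real) > 0"
    by simp_all
  ultimately show ?thesis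
    by blast
qed

end
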